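(* Let $d \geq 2$ be an integer, and let $(g_n)_{n \geq 1}$ be a sequence of monic polynomials of degree $d$ with coefficients in $\mathbb{Q}$. Suppose that for each $n$ there exists a partition $$M_{\mathbb{Q}} = A_n \cup B_n \cup C_n$$ for which the following hypotheses hold: 1. (Good Reduction) For each prime $\ell \in A_n$, the minimum radius of a closed disk that contains $\mathcal{K}_{g_n,\ell}$ is $1$. 2. (Controlled Bad Reduction) The set $B_n$ is stable for $n \geq 1$ (that is, it is the same set for all $n \geq 1$) and contains $\infty$. For each $\ell \in B_n$, there exists $R_\ell \geq 1$, independent of $n$, such that the $\ell$-adic filled Julia set $\mathcal{K}_{g_n,\ell} \cap \mathbb{Q}_\ell$ is contained inside the disk $D(0, R_\ell)$. 3. (Uncontrolled Bad Reduction) The cardinality of $C_n$ is stable (that is, independent of $n$). For each $\ell \in C_n$, if $r_{n,\ell}$ is the minimum radius of a closed disk containing the filled Julia set $\mathcal{K}_{g_n,\ell}$, then $\min\{r_{n,\ell} : \ell \in C_n\}$ tends to infinity with $n$. If $\#C_n \geq 1$, then $\#\mathrm{PrePer}(g_n, \mathbb{Q}) \leq d^{\#C_n + 1}$ for all $n$ sufficiently large.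
   Context: $M_{\mathbb{Q}}$ is the set of primes (places) of $\mathbb{Q}$, i.e. all prime numbers together with $\infty$. For $\ell \in M_{\mathbb{Q}}$, $\mathbb{Q}_\ell$ is the completion of $\mathbb{Q}$ at $\ell$ with its standard absolute value $|\cdot|_\ell$, and $\mathbb{C}_\ell$ is the completion of an algebraic closure of $\mathbb{Q}_\ell$; in particular $\mathbb{Q}_\infty = \mathbb{R}$ and $\mathbb{C}_\infty = \mathbb{C}$. For $a\in \mathbb{C}_\ell$ and $s>0$, $D(a,s) = \{x \in \mathbb{C}_\ell : |x-a|_\ell \leq s\}$ is the closed disk of radius $s$ about $a$; closed disks containing the filled Julia set at $\ell$ are disks in $\mathbb{C}_\ell$. For a polynomial $f \in \mathbb{Q}[z]$, with $m$-th iterate $f^m$, the filled Julia set of $f$ at $\ell$ is $$\mathcal{K}_{f,\ell} = \{x \in \mathbb{C}_\ell : f^m(x) \not\to \infty \text{ as } m\to\infty\}.$$ $\mathrm{PrePer}(f,\mathbb{Q})$ is the set of $x \in \mathbb{Q}$ with finite forward orbit under iteration of $f$.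
   Formalization: The stable set B_n of controlled places is additionally assumed to be finite; for infinite B_n the claim fails (e.g. suitable families z^2+c_n with #C_n = 1 and 8 rational preperiodic points). *)

theory Defs
  imports
    "HOL-Algebra.Algebraic_Closure"
    "HOL-Computational_Algebra.Computational_Algebra"
    "HOL-Analysis.Analysis"
begin

section \<open>Places of the rationals\<close>

datatype place = Finite_Place nat | Infinite_Place

definition places_of_Q :: "place set" where
  "places_of_Q = insert Infinite_Place (Finite_Place ` {p. Factorial_Ring.prime p})"

text \<open>The standard absolute values: for a prime \<open>p\<close> the one with value \<open>1/p\<close> at \<open>p\<close>.\<close>

fun place_abs :: "place \<Rightarrow> rat \<Rightarrow> real" where
  "place_abs Infinite_Place q = \<bar>real_of_rat q\<bar>"
| "place_abs (Finite_Place p) q =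
     (if q = 0 then 0
      else real p powi (int (Factorial_Ring.multiplicity (int p) (snd (quotient_of q)))
                        - int (Factorial_Ring.multiplicity (int p) (fst (quotient_of q)))))"

section \<open>Completions of algebraic closures\<close>

text \<open>The canonical map from the rationals to a field of characteristic \<open>0\<close>.\<close>

definition rat_emb :: "('a, 'b) ring_scheme \<Rightarrow> rat \<Rightarrow> 'a" where
  "rat_emb R q = add_pow R (fst (quotient_of q)) \<one>\<^bsub>R\<^esub>
                   \<otimes>\<^bsub>R\<^esub> inv\<^bsub>R\<^esub> (add_pow R (snd (quotient_of q)) \<one>\<^bsub>R\<^esub>)"

text \<open>The locale \<^locale>\<open>Metric_space\<close> constrains the distance on the whole type, hence the
  value \<open>0\<close> outside the carrier.\<close>

definition val_dist :: "('a, 'b) ring_scheme \<Rightarrow> ('a \<Rightarrow> real) \<Rightarrow> 'a \<Rightarrow> 'a \<Rightarrow> real" where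
  "val_dist R v x y =
     (if x \<in> carrier R \<and> y \<in> carrier R then v (x \<ominus>\<^bsub>R\<^esub> y) else 0)"

locale valued_field = field R for R (structure) +
  fixes v :: "'a \<Rightarrow> real"
  assumes v_nonneg: "x \<in> carrier R \<Longrightarrow> 0 \<le> v x"
    and v_eq_0: "x \<in> carrier R \<Longrightarrow> v x = 0 \<longleftrightarrow> x = \<zero>"
    and v_mult: "x \<in> carrier R \<Longrightarrow> y \<in> carrier R \<Longrightarrow> v (x \<otimes> y) = v x * v y"
    and v_add: "x \<in> carrier R \<Longrightarrow> y \<in> carrier R \<Longrightarrow> v (x \<oplus> y) \<le> v x + v y"
begin

lemma v_one: "v \<one> = 1"
proof -
  have "v \<one> * v \<one> = v \<one>" using v_mult[of \<one> \<one>] by simp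
  moreover have "v \<one> \<noteq> 0" using v_eq_0[of \<one>] by simp
  ultimately show ?thesis by simp
qed

lemma v_uminus:
  assumes "x \<in> carrier R" shows "v (\<ominus> x) = v x"
proof -
  have "v (\<ominus> \<one>) * v (\<ominus> \<one>) = 1"
    using v_mult[of "\<ominus> \<one>" "\<ominus> \<one>"] v_one by (simp add: l_minus)
  then have "v (\<ominus> \<one>) = 1"
    using v_nonneg[of "\<ominus> \<one>"] by (simp add: square_eq_1_iff)
  then show ?thesis using v_mult[of "\<ominus> \<one>" x] assms by (simp add: l_minus)
qed

sublocale Metric: Metric_space "carrier R" "val_dist R v"
proof
  fix x y z
  show "0 \<le> val_dist R v x y"
    by (simp add: val_dist_def v_nonneg)
  have "v (x \<ominus> y) = v (y \<ominus> x)" if "x \<in> carrier R" "y \<in> carrier R"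
  proof -
    have "\<ominus> (x \<ominus> y) = y \<ominus> x"
      using that by (simp add: a_minus_def minus_add add.m_comm)
    then show ?thesis using v_uminus[of "x \<ominus> y"] that by simp
  qed
  then show "val_dist R v x y = val_dist R v y x"
    by (auto simp: val_dist_def)
  assume x: "x \<in> carrier R" and y: "y \<in> carrier R"
  then show "val_dist R v x y = 0 \<longleftrightarrow> x = y"
    by (simp add: val_dist_def v_eq_0)
  assume z: "z \<in> carrier R"
  have "x \<ominus> z = (x \<ominus> y) \<oplus> (y \<ominus> z)"
    using x y z by (simp add: a_minus_def a_assoc r_neg1)
  then show "val_dist R v x z \<le> val_dist R v x y + val_dist R v y z"
    using v_add[of "x \<ominus> y" "y \<ominus> z"] x y z by (simp add: val_dist_def)
qed

definition rat_closure :: "'a set" where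
  "rat_closure = Metric.mtopology closure_of (range (rat_emb R))"

end

text \<open>
  \<open>(R, v)\<close> is a model of \<open>\<complex>\<^sub>\<ell>\<close>.  Since \<open>R\<close> is complete, the closure of the rationals in \<open>R\<close> is
  the completion \<open>\<rat>\<^sub>\<ell>\<close>; some subfield of \<open>R\<close> is an algebraic closure of it, and \<open>R\<close> is the
  completion of that subfield, i.e. complete with the subfield dense.  This determines \<open>(R, v)\<close>
  up to isometric isomorphism.  For \<open>\<ell> = \<infinity>\<close> it describes the complex numbers.
\<close>

locale completed_algebraic_closure = valued_field R v for R (structure) and v +
  fixes l :: place
  assumes v_rat: "v (rat_emb R q) = place_abs l q"
    and complete: "Metric.mcomplete"
    and dense_algebraic_closure:
      "\<exists>A. subfield A R \<and> algebraic_closure (R\<lparr>carrier := A\<rparr>) rat_closure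
           \<and> Metric.mtopology closure_of A = carrier R"

definition closed_disk :: "('a, 'b) ring_scheme \<Rightarrow> ('a \<Rightarrow> real) \<Rightarrow> 'a \<Rightarrow> real \<Rightarrow> 'a set" where
  "closed_disk R v a s = {x \<in> carrier R. v (x \<ominus>\<^bsub>R\<^esub> a) \<le> s}"

section \<open>Dynamics of rational polynomials\<close>

text \<open>\<^const>\<open>ring.eval\<close> takes the list of coefficients with the leading one first.\<close>

definition rat_poly_eval :: "('a, 'b) ring_scheme \<Rightarrow> rat poly \<Rightarrow> 'a \<Rightarrow> 'a" where
  "rat_poly_eval R f x = ring.eval R (map (rat_emb R) (rev (coeffs f))) x"

definition filled_julia ::
  "('a, 'b) ring_scheme \<Rightarrow> ('a \<Rightarrow> real) \<Rightarrow> rat poly \<Rightarrow> 'a set" where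
  "filled_julia R v f =
     {x \<in> carrier R. \<not> filterlim (\<lambda>m. v ((rat_poly_eval R f ^^ m) x)) at_top sequentially}"

definition is_min_disk_radius ::
  "('a, 'b) ring_scheme \<Rightarrow> ('a \<Rightarrow> real) \<Rightarrow> 'a set \<Rightarrow> real \<Rightarrow> bool" where
  "is_min_disk_radius R v S r \<longleftrightarrow>
     (let T = {s. s > 0 \<and> (\<exists>a \<in> carrier R. S \<subseteq> closed_disk R v a s)}
      in r \<in> T \<and> (\<forall>s \<in> T. r \<le> s))"

definition rat_preperiodic :: "rat poly \<Rightarrow> rat set" where
  "rat_preperiodic f = {x. finite (range (\<lambda>m. (poly f ^^ m) x))}"

end

theory Submission
  imports Defs "HOL-Real_Asymp.Real_Asymp"
begin

text \<open>
  At a place \<open>l\<close> of \<open>C\<^sub>n\<close>, factor \<open>g\<^sub>n(x) - w = \<Prod>(x - z\<^sub>i)\<close> for a preperiodic point \<open>w\<close>.  Minimality of the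
  radius \<open>r\<close> forces every \<open>x\<close> to be at distance at least \<open>r\<close> from some \<open>z\<^sub>i\<close>; the other \<open>d - 1\<close>
  factors then have product at most \<open>\<bar>g\<^sub>n(x) - w\<bar> / r\<close>.  For preperiodic \<open>x\<close> the numerator is at most
  \<open>r\<close>, so the rational preperiodic points fall into \<open>d\<close> classes of diameter at most \<open>1\<close>.  Applied
  again, with the \<open>z\<^sub>i\<close> in place of \<open>w\<close>, the same estimate refines this to \<open>d\<^sup>2\<close> classes of diameter
  at most \<open>(1 / r)\<^bsup>1 / (d - 1)\<^esup>\<close>.  If there are more than \<open>d\<^bsup>#C + 1\<^esup>\<close> rational preperiodic points, then
  two of them share a class of the fine partition at one place of \<open>C\<^sub>n\<close> and of the coarse partition
  at all the others, and their difference violates the product formula once \<open>r\<close> is large.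
\<close>

section \<open>Polynomials and the ultrametric inequality over a valued field\<close>

text \<open>This is Horner's scheme: the coefficients of \<open>q\<close> are the successive partial
  values at \<open>z\<close>, so induction appends one coefficient on the right. They stay in
  \<open>A\<close>, while the identity holds at every \<open>x\<close> of the larger ring.\<close>

lemma (in cring) synthetic_division:
  assumes A: "subring A R" and p: "p \<noteq> []" "set p \<subseteq> A" and z: "z \<in> A"
  shows "\<exists>q. set q \<subseteq> A \<and> Suc (length q) = length p \<and> (q \<noteq> [] \<longrightarrow> hd q = hd p) \<and>
           (\<forall>x\<in>carrier R. eval p x = (x \<ominus> z) \<otimes> eval q x \<oplus> eval p z)"
  using p
proof (induction p rule: rev_nonempty_induct)
  case (single a)
  have "a \<in> carrier R" "z \<in> carrier R"
    using single z subringE(1)[OF A] by auto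
  then show ?case
    by (intro exI[of _ "[]"]) auto
next
  case (snoc a p)
  have incl: "A \<subseteq> carrier R"
    by (rule subringE(1)[OF A])
  have pA: "set p \<subseteq> A" and a: "a \<in> carrier R" and zR: "z \<in> carrier R"
    using snoc.prems z incl by auto
  obtain q where q: "set q \<subseteq> A" "Suc (length q) = length p" "q \<noteq> [] \<Longrightarrow> hd q = hd p"
    and ev: "\<And>x. x \<in> carrier R \<Longrightarrow> eval p x = (x \<ominus> z) \<otimes> eval q x \<oplus> eval p z"
    using snoc.IH[OF pA] by blast
  have e: "eval p z \<in> A"
    using ring.eval_in_carrier[OF subring_is_ring[OF A], of p z] pA z
    by (simp add: eval_consistent[OF A])
  have "eval (p @ [a]) x = (x \<ominus> z) \<otimes> eval (q @ [eval p z]) x \<oplus> eval (p @ [a]) z"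
    if x: "x \<in> carrier R" for x
  proof -
    have qx: "eval q x \<in> carrier R" "eval p z \<in> carrier R"
      using q(1) pA incl x zR by (auto intro!: eval_in_carrier)
    show ?thesis
      using pA q(1) incl a x zR qx e
      by (subst (1 2 3) eval_append_aux) (auto simp: ev[OF x], algebra)
  qed
  moreover have "hd (q @ [eval p z]) = hd (p @ [a])"
  \<comment> \<open>For constant \<open>p\<close> the quotient is empty, and the new head
    \<open>eval p z\<close> is that constant.\<close>
  proof (cases "q = []")
    case True
    then obtain b where "p = [b]"
      using q(2) by (metis length_0_conv length_Suc_conv)
    moreover from this have "b \<in> carrier R"
      using pA incl by auto
    ultimately show ?thesis
      using True zR by simp
  next
    case False
    then show ?thesis
      using q(3) snoc.hyps by simp
  qed
  ultimately show ?case
    using q e by (intro exI[of _ "q @ [eval p z]"]) auto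
qed

lemma (in domain) splitted_imp_root:
  assumes "p \<in> carrier (poly_ring R)" "splitted p" "length p > 1"
  shows "\<exists>z\<in>carrier R. eval p z = \<zero>"
proof -
  have "roots p \<noteq> {#}"
    using assms(2,3) unfolding splitted_def by auto
  then obtain z where "z \<in># roots p"
    by blast
  then have "is_root p z"
    using roots_mem_iff_is_root[OF assms(1)] by simp
  then show ?thesis
    unfolding is_root_def by auto
qed

text \<open>Roots are split off one at a time. They are taken in the algebraically closed subfield
  \<open>A\<close>, since \<open>R\<close> itself is not known to be algebraically closed here, but
  the factorization is evaluated on all of \<open>R\<close>.\<close>

lemma (in valued_field) v_monic_eval_eq_prod_list:
  assumes A: "subfield A R" and closed: "algebraically_closed (R\<lparr>carrier := A\<rparr>)"
    and p: "set p \<subseteq> A" "length p = Suc n" "hd p = \<one>"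
  shows "\<exists>zs. set zs \<subseteq> A \<and> length zs = n \<and>
           (\<forall>x\<in>carrier R. v (eval p x) = (\<Prod>z\<leftarrow>zs. v (x \<ominus> z)))"
  using p
proof (induction n arbitrary: p)
  case 0
  then have "p = [\<one>]"
    by (cases p) auto
  then show ?case
    by (intro exI[of _ "[]"]) (auto simp: v_one)
next
  case (Suc n)
  interpret L: algebraically_closed "R\<lparr>carrier := A\<rparr>"
    by (rule closed)
  have subring: "subring A R"
    using subfieldE(1)[OF A] .
  have incl: "A \<subseteq> carrier R"
    using subringE(1)[OF subring] .
  have "p \<noteq> []"
    using Suc.prems by auto
  have "p \<in> carrier (poly_ring (R\<lparr>carrier := A\<rparr>))"
    using Suc.prems(1,3) \<open>p \<noteq> []\<close>
    by (simp add: univ_poly_carrier[symmetric] polynomial_def)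
  then obtain z where z: "z \<in> A" "eval p z = \<zero>"
    using L.splitted_imp_root[of p] L.roots_over_carrier[of p] Suc.prems(2)
    by (auto simp: eval_consistent[OF subring])
  obtain q where q: "set q \<subseteq> A" "Suc (length q) = length p" "q \<noteq> [] \<Longrightarrow> hd q = hd p"
    and ev: "\<And>x. x \<in> carrier R \<Longrightarrow> eval p x = (x \<ominus> z) \<otimes> eval q x \<oplus> eval p z"
    using synthetic_division[OF subring \<open>p \<noteq> []\<close> Suc.prems(1) z(1)] by blast
  have "length q = Suc n" "hd q = \<one>"
    using q Suc.prems by force+
  then obtain zs where zs: "set zs \<subseteq> A" "length zs = n"
      "\<And>x. x \<in> carrier R \<Longrightarrow> v (eval q x) = (\<Prod>z\<leftarrow>zs. v (x \<ominus> z))"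
    using Suc.IH[OF q(1)] by blast
  have "v (eval p x) = (\<Prod>z\<leftarrow>z # zs. v (x \<ominus> z))" if x: "x \<in> carrier R" for x
  proof -
    have c: "eval q x \<in> carrier R" "z \<in> carrier R"
      using q(1) z(1) incl x by (auto intro!: eval_in_carrier)
    then have "eval p x = (x \<ominus> z) \<otimes> eval q x"
      using ev[OF x] z(2) x by simp
    then show ?thesis
      using c x zs(3)[OF x] by (simp add: v_mult)
  qed
  then show ?case
    using zs z by (intro exI[of _ "z # zs"]) auto
qed

text \<open>The powers \<open>(1 + x) ^ n\<close> are integral combinations of \<open>1, x, \<dots>, x ^ n\<close>, hence of absolute
  value at most \<open>n + 1\<close> when \<open>v x \<le> 1\<close>; taking \<open>n\<close>-th roots gives \<open>v (1 + x) \<le> 1\<close>.\<close>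

lemma (in valued_field) ultrametric_if_v_nat_le_1:
  assumes nat: "\<And>m::nat. v ([m] \<cdot> \<one>) \<le> 1" and xy: "x \<in> carrier R" "y \<in> carrier R"
  shows "v (x \<oplus> y) \<le> max (v x) (v y)"
proof -
  have one_plus: "v (\<one> \<oplus> x) \<le> 1" if x: "x \<in> carrier R" "v x \<le> 1" for x
  proof -
    \<comment> \<open>\<open>B n\<close> collects the values at \<open>x\<close> of polynomials of
      degree at most \<open>n\<close> with natural number coefficients, in Horner form.\<close>
    define B where "B = rec_nat (range (\<lambda>m::nat. [m] \<cdot> \<one>))
                          (\<lambda>_ S. {[m] \<cdot> \<one> \<oplus> x \<otimes> b | (m::nat) b. b \<in> S})"
    have B_0: "B 0 = range (\<lambda>m::nat. [m] \<cdot> \<one>)"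
      and B_Suc: "B (Suc n) = {[m] \<cdot> \<one> \<oplus> x \<otimes> b | (m::nat) b. b \<in> B n}" for n
      by (simp_all add: B_def)
    have B_bound: "b \<in> carrier R \<and> v b \<le> real n + 1" if "b \<in> B n" for b n
      using that
    proof (induction n arbitrary: b)
      case 0
      then show ?case
        using nat by (auto simp: B_0)
    next
      case (Suc n)
      then obtain m :: nat and c where b: "b = [m] \<cdot> \<one> \<oplus> x \<otimes> c" and c: "c \<in> B n"
        by (auto simp: B_Suc)
      have cR: "c \<in> carrier R" and vc: "v c \<le> real n + 1"
        using Suc.IH[OF c] by auto
      have "v x * v c \<le> 1 * (real n + 1)"
        using x vc cR by (intro mult_mono) (auto simp: v_nonneg)
      moreover have "v b \<le> v ([m] \<cdot> \<one>) + v x * v c"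
        using v_add[of "[m] \<cdot> \<one>" "x \<otimes> c"] x cR by (simp add: b v_mult)
      ultimately show ?case
        using nat[of m] x cR by (simp add: b)
    qed
    have B_add: "[m] \<cdot> \<one> \<oplus> b \<in> B n" if "b \<in> B n" for b n and m :: nat
    proof (cases n)
      case 0
      then show ?thesis
        using that by (auto simp: B_0 add.nat_pow_mult)
    next
      case (Suc k)
      then obtain j :: nat and c where b: "b = [j] \<cdot> \<one> \<oplus> x \<otimes> c" and c: "c \<in> B k"
        using \<open>b \<in> B n\<close> by (auto simp: B_Suc)
      have "[m] \<cdot> \<one> \<oplus> b = [(m + j)] \<cdot> \<one> \<oplus> x \<otimes> c"
        using x B_bound[OF c] by (simp add: b add.nat_pow_mult[symmetric] a_assoc)
      then show ?thesis
        using c unfolding Suc B_Suc by blast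
    qed
    have B_mult: "(\<one> \<oplus> x) \<otimes> b \<in> B (Suc n)" if "b \<in> B n" for b n
      using that
    proof (induction n arbitrary: b)
      case 0
      then obtain m :: nat where b: "b = [m] \<cdot> \<one>"
        by (auto simp: B_0)
      then have "(\<one> \<oplus> x) \<otimes> b = [m] \<cdot> \<one> \<oplus> x \<otimes> b"
        using x by (simp add: l_distr)
      then show ?case
        using 0 b unfolding B_Suc by blast
    next
      case (Suc n)
      then obtain m :: nat and c where b: "b = [m] \<cdot> \<one> \<oplus> x \<otimes> c" and c: "c \<in> B n"
        by (auto simp: B_Suc)
      have "[m] \<cdot> \<one> \<in> carrier R" "c \<in> carrier R"
        using B_bound[OF c] by auto
      \<comment> \<open>This restores Horner form: the inner bracket lies in
        \<open>B (Suc n)\<close> by the induction hypothesis and \<open>B_add\<close>.\<close>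
      then have "(\<one> \<oplus> x) \<otimes> b = [m] \<cdot> \<one> \<oplus> x \<otimes> ([m] \<cdot> \<one> \<oplus> (\<one> \<oplus> x) \<otimes> c)"
        using x(1) unfolding b by algebra
      then show ?case
        using B_add[OF Suc.IH[OF c], of m] unfolding B_Suc[of "Suc n"] by blast
    qed
    have pow: "(\<one> \<oplus> x) [^] n \<in> B n" for n :: nat
    proof (induction n)
      case 0
      have "[(1::nat)] \<cdot> \<one> = \<one>"
        by simp
      then show ?case
        unfolding B_0 nat_pow_0 by (metis rangeI)
    next
      case (Suc n)
      then show ?case
        using B_mult[OF Suc] x B_bound[OF Suc] by (simp add: m_comm)
    qed
    have v_pow: "v ((\<one> \<oplus> x) [^] n) = v (\<one> \<oplus> x) ^ n" for n :: nat
      using x by (induction n) (auto simp: v_one v_mult)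
    have bound: "v (\<one> \<oplus> x) ^ n \<le> real n + 1" for n
      using B_bound[OF pow, of n] by (simp add: v_pow)
    show ?thesis
    proof (rule ccontr)
      assume "\<not> v (\<one> \<oplus> x) \<le> 1"
      then have "eventually (\<lambda>n. real n + 1 < v (\<one> \<oplus> x) ^ n) sequentially"
        by real_asymp
      then obtain n where "real n + 1 < v (\<one> \<oplus> x) ^ n"
        by (auto dest: eventually_happens)
      then show False
        using bound[of n] by simp
    qed
  qed
  \<comment> \<open>Dividing by the larger summand reduces to \<open>one_plus\<close>.\<close>
  have *: "v (x \<oplus> y) \<le> v x" if x: "x \<in> carrier R" and y: "y \<in> carrier R" and "v y \<le> v x" for x y
  proof (cases "x = \<zero>")
    case True
    then have "v y = 0"
      using \<open>v y \<le> v x\<close> v_nonneg[OF y] v_eq_0[OF x] by simp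
    then show ?thesis
      using True y v_nonneg[OF x] by simp
  next
    case False
    then have unit: "x \<in> Units R"
      using x by (simp add: field_Units)
    have "v x > 0"
      using False v_nonneg[OF x] v_eq_0[OF x] by linarith
    have inv: "inv x \<in> carrier R" "x \<otimes> inv x = \<one>"
      using unit by auto
    have "v x * v (inv x \<otimes> y) = v y"
      using v_mult[of x "inv x \<otimes> y"] inv x y m_assoc[of x "inv x" y] by simp
    then have "v (inv x \<otimes> y) \<le> 1"
      using \<open>v x > 0\<close> \<open>v y \<le> v x\<close> by (metis mult_le_cancel_left_pos mult.right_neutral)
    then have "v (\<one> \<oplus> inv x \<otimes> y) \<le> 1"
      using inv y by (intro one_plus) auto
    moreover have "x \<oplus> y = x \<otimes> (\<one> \<oplus> inv x \<otimes> y)"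
      using inv x y m_assoc[of x "inv x" y] by (simp add: r_distr)
    ultimately show ?thesis
      using \<open>v x > 0\<close> inv x y by (simp add: v_mult mult_left_le)
  qed
  show ?thesis
    using *[OF xy] *[OF xy(2,1)] xy by (cases "v y \<le> v x") (auto simp: a_comm)
qed

section \<open>The embedding of the rationals\<close>

lemma place_abs_eq_0_iff:
  assumes "l \<in> places_of_Q" shows "place_abs l q = 0 \<longleftrightarrow> q = 0"
  using assms by (auto simp: places_of_Q_def power_int_eq_0_iff split: if_splits)

lemma place_abs_of_int_le_1: "place_abs (Finite_Place p) (of_int k) \<le> 1"
proof (cases "p = 0")
  case False
  then have "real p powi - int m \<le> 1" for m
    by (simp add: power_int_minus inverse_le_1_iff)
  then show ?thesis
    by (simp add: quotient_of_int multiplicity_unit_right)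
qed (simp add: quotient_of_int)

locale completed_algebraic_closure_at_place = completed_algebraic_closure +
  assumes l_place: "l \<in> places_of_Q"
begin

section \<open>The embedding is a ring homomorphism\<close>

lemma rat_emb_of_int: "rat_emb R (of_int k) = [k] \<cdot> \<one>"
  by (simp add: rat_emb_def quotient_of_int add.int_pow_1)

text \<open>Characteristic zero follows from \<open>v_rat\<close>, because the absolute value of a
  nonzero rational does not vanish at a genuine place.\<close>

lemma int_mult_one_eq_zero_iff: "[(k::int)] \<cdot> \<one> = \<zero> \<longleftrightarrow> k = 0"
proof -
  have "v ([k] \<cdot> \<one>) = place_abs l (of_int k)"
    using v_rat[of "of_int k"] by (simp add: rat_emb_of_int)
  then show ?thesis
    using v_eq_0[of "[k] \<cdot> \<one>"] place_abs_eq_0_iff[OF l_place, of "of_int k"] by simp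
qed

lemma int_mult_one_add: "[(i + j :: int)] \<cdot> \<one> = [i] \<cdot> \<one> \<oplus> [j] \<cdot> \<one>"
  by (simp add: add.int_pow_mult)

lemma int_mult_one_mult: "[(i * j :: int)] \<cdot> \<one> = [i] \<cdot> \<one> \<otimes> [j] \<cdot> \<one>"
  by (simp add: add_pow_ldistr_int add.int_pow_pow mult.commute)

lemma rat_emb_closed [simp]: "rat_emb R q \<in> carrier R"
proof -
  have "[snd (quotient_of q)] \<cdot> \<one> \<noteq> \<zero>"
    by (metis int_mult_one_eq_zero_iff less_irrefl quotient_of_denom_pos')
  then show ?thesis
    unfolding rat_emb_def by (auto simp: field_Units)
qed

text \<open>\<open>rat_emb\<close> is defined through lowest terms; this frees it from them. With
  cancellation it characterizes the image of \<open>q\<close> by any fraction representing it, so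
  sums and products need only a common denominator.\<close>

lemma int_mult_rat_emb:
  assumes "of_int b * q = of_int a"
  shows "[b] \<cdot> \<one> \<otimes> rat_emb R q = [a] \<cdot> \<one>"
proof -
  obtain n m where nm: "quotient_of q = (n, m)"
    by fastforce
  have m: "m > 0" "q = of_int n / of_int m"
    using quotient_of_denom_pos[OF nm] quotient_of_div[OF nm] by auto
  have "of_int (b * n) = (of_int (a * m) :: rat)"
    using assms m by (simp add: field_simps)
  then have eq: "b * n = a * m"
    by (simp only: of_int_eq_iff)
  have unit: "[m] \<cdot> \<one> \<in> Units R"
    using m int_mult_one_eq_zero_iff[of m] by (simp add: field_Units)
  have "[b] \<cdot> \<one> \<otimes> rat_emb R q = ([b] \<cdot> \<one> \<otimes> [n] \<cdot> \<one>) \<otimes> inv ([m] \<cdot> \<one>)"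
    using unit by (simp add: rat_emb_def nm m_assoc)
  also have "\<dots> = ([a] \<cdot> \<one> \<otimes> [m] \<cdot> \<one>) \<otimes> inv ([m] \<cdot> \<one>)"
    by (simp only: eq flip: int_mult_one_mult)
  also have "\<dots> = [a] \<cdot> \<one>"
    using unit by (simp add: m_assoc)
  finally show ?thesis .
qed

lemma rat_emb_eqI:
  assumes "b \<noteq> 0" "of_int b * q = of_int a" "y \<in> carrier R" "[b] \<cdot> \<one> \<otimes> y = [a] \<cdot> \<one>"
  shows "rat_emb R q = y"
  using m_lcancel[of "[b] \<cdot> \<one>" "rat_emb R q" y] int_mult_rat_emb[OF assms(2)] assms
  by (simp add: int_mult_one_eq_zero_iff)

lemma ex_int_multiple: "\<exists>b a. b \<noteq> 0 \<and> of_int b * (q::rat) = of_int a"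
proof -
  obtain n m where nm: "quotient_of q = (n, m)"
    by fastforce
  show ?thesis
    using quotient_of_denom_pos[OF nm] quotient_of_div[OF nm]
    by (intro exI[of _ m] exI[of _ n]) auto
qed

lemma rat_emb_add: "rat_emb R (x + y) = rat_emb R x \<oplus> rat_emb R y"
proof -
  obtain b a d c where x: "b \<noteq> 0" "of_int b * x = of_int a"
    and y: "d \<noteq> 0" "of_int d * y = of_int c"
    using ex_int_multiple by metis
  note e = int_mult_rat_emb[OF x(2)] int_mult_rat_emb[OF y(2)]
  show ?thesis
  proof (rule rat_emb_eqI[where b = "b * d" and a = "a * d + b * c"])
    show "of_int (b * d) * (x + y) = of_int (a * d + b * c)"
      by (simp add: x(2)[symmetric] y(2)[symmetric] algebra_simps)
    have "[b] \<cdot> \<one> \<otimes> [d] \<cdot> \<one> \<otimes> (rat_emb R x \<oplus> rat_emb R y) =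
        ([b] \<cdot> \<one> \<otimes> rat_emb R x) \<otimes> [d] \<cdot> \<one> \<oplus> [b] \<cdot> \<one> \<otimes> ([d] \<cdot> \<one> \<otimes> rat_emb R y)"
      using rat_emb_closed[of x] rat_emb_closed[of y] add.int_pow_closed[OF one_closed, of b]
        add.int_pow_closed[OF one_closed, of d]
      by algebra
    then show "[(b * d)] \<cdot> \<one> \<otimes> (rat_emb R x \<oplus> rat_emb R y) = [(a * d + b * c)] \<cdot> \<one>"
      by (simp add: e int_mult_one_mult int_mult_one_add)
  qed (use x y in auto)
qed

lemma rat_emb_mult: "rat_emb R (x * y) = rat_emb R x \<otimes> rat_emb R y"
proof -
  obtain b a d c where x: "b \<noteq> 0" "of_int b * x = of_int a"
    and y: "d \<noteq> 0" "of_int d * y = of_int c"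
    using ex_int_multiple by metis
  note e = int_mult_rat_emb[OF x(2)] int_mult_rat_emb[OF y(2)]
  show ?thesis
  proof (rule rat_emb_eqI[where b = "b * d" and a = "a * c"])
    show "of_int (b * d) * (x * y) = of_int (a * c)"
      by (simp add: x(2)[symmetric] y(2)[symmetric])
    have "[b] \<cdot> \<one> \<otimes> [d] \<cdot> \<one> \<otimes> (rat_emb R x \<otimes> rat_emb R y) =
        ([b] \<cdot> \<one> \<otimes> rat_emb R x) \<otimes> ([d] \<cdot> \<one> \<otimes> rat_emb R y)"
      using rat_emb_closed[of x] rat_emb_closed[of y] add.int_pow_closed[OF one_closed, of b]
        add.int_pow_closed[OF one_closed, of d]
      by algebra
    then show "[(b * d)] \<cdot> \<one> \<otimes> (rat_emb R x \<otimes> rat_emb R y) = [(a * c)] \<cdot> \<one>"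
      by (simp add: e int_mult_one_mult)
  qed (use x y in auto)
qed

lemma rat_emb_0 [simp]: "rat_emb R 0 = \<zero>"
  using rat_emb_of_int[of 0] int_mult_one_eq_zero_iff[of 0] by simp

lemma rat_emb_1 [simp]: "rat_emb R 1 = \<one>"
  using rat_emb_of_int[of 1] by (simp add: add.int_pow_1)

lemma rat_emb_diff: "rat_emb R (x - y) = rat_emb R x \<ominus> rat_emb R y"
proof -
  have "rat_emb R x \<ominus> rat_emb R y = (rat_emb R (x - y) \<oplus> rat_emb R y) \<ominus> rat_emb R y"
    by (simp flip: rat_emb_add)
  also have "\<dots> = rat_emb R (x - y)"
    using rat_emb_closed[of y] rat_emb_closed[of "x - y"] by algebra
  finally show ?thesis ..
qed

lemma v_rat_emb_diff: "v (rat_emb R x \<ominus> rat_emb R y) = place_abs l (x - y)"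
  by (simp add: v_rat flip: rat_emb_diff)

section \<open>Rational polynomials and filled Julia sets over \<open>R\<close>\<close>

lemma rat_emb_coeffs_closed: "set (map (rat_emb R) (rev (coeffs f))) \<subseteq> carrier R"
  by auto

lemma rat_poly_eval_closed [simp]: "x \<in> carrier R \<Longrightarrow> rat_poly_eval R f x \<in> carrier R"
  unfolding rat_poly_eval_def by (intro eval_in_carrier rat_emb_coeffs_closed)

lemma rat_poly_eval_rat_emb: "rat_poly_eval R f (rat_emb R x) = rat_emb R (poly f x)"
proof (induction f)
  case 0
  then show ?case
    by (simp add: rat_poly_eval_def)
next
  case (pCons a f)
  have "rat_poly_eval R (pCons a f) (rat_emb R x) =
      rat_poly_eval R f (rat_emb R x) \<otimes> rat_emb R x \<oplus> rat_emb R a"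
    unfolding rat_poly_eval_def using pCons.hyps rat_emb_coeffs_closed[of f]
    by (simp add: cCons_def eval_append_aux)
  then show ?case
    by (simp add: pCons.IH rat_emb_add rat_emb_mult a_comm m_comm)
qed

text \<open>A finite orbit has bounded absolute values, which cannot tend to infinity.\<close>

lemma rat_emb_preperiodic_in_filled_julia:
  assumes "x \<in> rat_preperiodic f"
  shows "rat_emb R x \<in> filled_julia R v f"
proof -
  have iter: "(rat_poly_eval R f ^^ m) (rat_emb R x) = rat_emb R ((poly f ^^ m) x)" for m
    by (induction m) (simp_all add: rat_poly_eval_rat_emb)
  have "finite ((\<lambda>q. v (rat_emb R q)) ` range (\<lambda>m. (poly f ^^ m) x))"
    using assms by (simp add: rat_preperiodic_def)
  then have "finite (range (\<lambda>m. v ((rat_poly_eval R f ^^ m) (rat_emb R x))))"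
    by (simp add: iter image_image)
  then obtain c where c: "\<And>m. v ((rat_poly_eval R f ^^ m) (rat_emb R x)) \<le> c"
    using bdd_above_finite unfolding bdd_above_def by (metis rangeI)
  have "\<not> filterlim (\<lambda>m. v ((rat_poly_eval R f ^^ m) (rat_emb R x))) at_top sequentially"
  proof
    assume "filterlim (\<lambda>m. v ((rat_poly_eval R f ^^ m) (rat_emb R x))) at_top sequentially"
    then have "\<forall>\<^sub>F m in sequentially. c < v ((rat_poly_eval R f ^^ m) (rat_emb R x))"
      by (simp add: filterlim_at_top_dense)
    then obtain m where "c < v ((rat_poly_eval R f ^^ m) (rat_emb R x))"
      by (auto dest: eventually_happens)
    then show False
      using c[of m] by simp
  qed
  then show ?thesis
    by (simp add: filled_julia_def)
qed

text \<open>Dropping the first term of an orbit does not affect its limit. Forward invariance keeps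
  \<open>F y\<close> in the filled Julia set; backward invariance puts the roots of
  \<open>F = w\<close> there.\<close>

lemma rat_poly_eval_in_filled_julia_iff:
  assumes "x \<in> carrier R"
  shows "rat_poly_eval R f x \<in> filled_julia R v f \<longleftrightarrow> x \<in> filled_julia R v f"
proof -
  have "filterlim (\<lambda>m. v ((rat_poly_eval R f ^^ m) (rat_poly_eval R f x))) at_top sequentially \<longleftrightarrow>
      filterlim (\<lambda>m. v ((rat_poly_eval R f ^^ Suc m) x)) at_top sequentially"
    by (simp add: funpow_swap1)
  also have "\<dots> \<longleftrightarrow> filterlim (\<lambda>m. v ((rat_poly_eval R f ^^ m) x)) at_top sequentially"
    by (rule filterlim_sequentially_Suc)
  finally show ?thesis
    using assms by (simp add: filled_julia_def)
qed

lemma rat_emb_in_rat_closure: "rat_emb R x \<in> rat_closure"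
proof -
  have "range (rat_emb R) \<subseteq> topspace Metric.mtopology"
    by auto
  then have "range (rat_emb R) \<subseteq> rat_closure"
    unfolding rat_closure_def by (rule closure_of_subset)
  then show ?thesis
    by blast
qed

text \<open>The infinite place is among the controlled ones, so only the ordinary triangle
  inequality is available; hence the factor 2.\<close>

lemma controlled_place_abs_diff:
  assumes "filled_julia R v f \<inter> rat_closure \<subseteq> closed_disk R v \<zero> s"
    and "x \<in> rat_preperiodic f" "y \<in> rat_preperiodic f"
  shows "place_abs l (x - y) \<le> 2 * s"
proof -
  have *: "v (rat_emb R z) \<le> s" if "z \<in> rat_preperiodic f" for z
  proof -
    have "rat_emb R z \<in> closed_disk R v \<zero> s"
      using assms(1) rat_emb_in_rat_closure rat_emb_preperiodic_in_filled_julia[OF that] by blast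
    then show ?thesis
      by (simp add: closed_disk_def a_minus_def)
  qed
  have "place_abs l (x - y) \<le> v (rat_emb R x) + v (rat_emb R y)"
    using v_add[of "rat_emb R x" "\<ominus> rat_emb R y"]
    by (simp add: v_uminus a_minus_def flip: v_rat_emb_diff)
  then show ?thesis
    using *[OF assms(2)] *[OF assms(3)] by simp
qed

end

section \<open>Dynamics at a finite place\<close>

lemma power_le_prod_list:
  fixes m :: real
  assumes "0 \<le> m" "\<And>y. y \<in> set ys \<Longrightarrow> m \<le> y"
  shows "m ^ length ys \<le> prod_list ys"
  using assms(2)
proof (induction ys)
  case (Cons y ys)
  have "m * m ^ length ys \<le> y * prod_list ys"
    using Cons assms(1) by (intro mult_mono) (auto intro: order_trans)
  then show ?case
    by simp
qed simp

text \<open>Once the large factor \<open>y0\<close> is removed, the smallest of the other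
  \<open>d - 1\<close> factors, raised to the power \<open>d - 1\<close>, is at most their
  product.\<close>

lemma ex_power_le_prod_list_div:
  fixes s V :: real
  assumes "length ys = d" "d \<ge> 2" and nonneg: "\<And>y. y \<in> set ys \<Longrightarrow> 0 \<le> y"
    and y0: "y0 \<in> set ys" "s \<le> y0" "0 < s" and V: "prod_list ys \<le> V"
  shows "\<exists>y\<in>set ys. y ^ (d - 1) \<le> V / s"
proof -
  obtain as bs where ys: "ys = as @ y0 # bs"
    using split_list[OF y0(1)] by blast
  define m where "m = Min (set (as @ bs))"
  have "as @ bs \<noteq> []" and len: "length (as @ bs) = d - 1"
    using assms(1,2) ys by (cases as; cases bs; simp)+
  then have m: "m \<in> set (as @ bs)" "\<And>y. y \<in> set (as @ bs) \<Longrightarrow> m \<le> y"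
    unfolding m_def by (intro Min_in Min_le; simp)+
  then have "m \<ge> 0"
    using nonneg ys by auto
  then have le: "m ^ (d - 1) \<le> prod_list (as @ bs)"
    using power_le_prod_list[of m "as @ bs"] m(2) len by simp
  have "s * m ^ (d - 1) \<le> y0 * prod_list (as @ bs)"
    using le y0 \<open>m \<ge> 0\<close> by (intro mult_mono) auto
  also have "\<dots> = prod_list ys"
    by (simp add: ys mult_ac)
  finally have "m ^ (d - 1) \<le> V / s"
    using V y0(3) by (simp add: field_simps)
  then show ?thesis
    using m(1) ys by auto
qed

lemma poly_in_rat_preperiodic:
  assumes "x \<in> rat_preperiodic f" shows "poly f x \<in> rat_preperiodic f"
proof -
  have "(poly f ^^ m) (poly f x) \<in> range (\<lambda>m. (poly f ^^ m) x)" for m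
    using rangeI[of "\<lambda>m. (poly f ^^ m) x" "Suc m"] by (simp add: funpow_swap1)
  then have "range (\<lambda>m. (poly f ^^ m) (poly f x)) \<subseteq> range (\<lambda>m. (poly f ^^ m) x)"
    by blast
  then show ?thesis
    using assms finite_subset by (auto simp: rat_preperiodic_def)
qed

locale nonarchimedean_dynamics = completed_algebraic_closure_at_place +
  fixes f :: "rat poly" and d :: nat
  assumes l_finite: "l \<noteq> Infinite_Place"
    and d_ge_2: "d \<ge> 2"
    and monic: "Polynomial.lead_coeff f = 1"
    and degree_eq: "Polynomial.degree f = d"
begin

abbreviation F :: "'a \<Rightarrow> 'a" where "F \<equiv> rat_poly_eval R f"
abbreviation J :: "'a set" where "J \<equiv> filled_julia R v f"

section \<open>Ultrametric geometry at a finite place\<close>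

lemma ultrametric:
  assumes "x \<in> carrier R" "y \<in> carrier R"
  shows "v (x \<oplus> y) \<le> max (v x) (v y)"
proof (rule ultrametric_if_v_nat_le_1[OF _ assms])
  fix m :: nat
  obtain p where p: "l = Finite_Place p"
    using l_finite by (cases l) auto
  have "v ([(int m)] \<cdot> \<one>) \<le> 1"
    using v_rat[of "of_int (int m)"] place_abs_of_int_le_1[of p "int m"]
    unfolding rat_emb_of_int p by simp
  then show "v ([m] \<cdot> \<one>) \<le> 1"
    unfolding add_pow_def by (simp only: int_pow_int)
qed

lemma v_minus_commute:
  assumes "x \<in> carrier R" "y \<in> carrier R" shows "v (x \<ominus> y) = v (y \<ominus> x)"
proof -
  have "\<ominus> (x \<ominus> y) = y \<ominus> x"
    using assms by algebra
  then show ?thesis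
    using v_uminus[of "x \<ominus> y"] assms by simp
qed

lemma ultrametric_diff:
  assumes "x \<in> carrier R" "y \<in> carrier R" "z \<in> carrier R"
  shows "v (x \<ominus> z) \<le> max (v (x \<ominus> y)) (v (y \<ominus> z))"
proof -
  have "x \<ominus> z = (x \<ominus> y) \<oplus> (y \<ominus> z)"
    using assms by algebra
  then show ?thesis
    using ultrametric[of "x \<ominus> y" "y \<ominus> z"] assms by simp
qed

lemma ultrametric_common:
  assumes "x \<in> carrier R" "y \<in> carrier R" "z \<in> carrier R"
    and "v (x \<ominus> z) \<le> s" "v (y \<ominus> z) \<le> s"
  shows "v (x \<ominus> y) \<le> s"
  using ultrametric_diff[of x z y] v_minus_commute[of z y] assms by simp

lemma J_carrier: "x \<in> J \<Longrightarrow> x \<in> carrier R"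
  by (simp add: filled_julia_def)

text \<open>The set \<open>A\<close> is the dense algebraic closure, which contains the rationals.
  Targets \<open>w\<close> range over all of \<open>A\<close>, because roots found in one
  application become targets in the next.\<close>

lemma ex_algebraic_splitting:
  "\<exists>A. range (rat_emb R) \<subseteq> A \<and> A \<subseteq> carrier R \<and>
     (\<forall>w\<in>A. \<exists>zs. set zs \<subseteq> A \<and> length zs = d \<and>
        (\<forall>x\<in>carrier R. v (F x \<ominus> w) = (\<Prod>z\<leftarrow>zs. v (x \<ominus> z))))"
proof -
  obtain A where A: "subfield A R" and closure: "algebraic_closure (R\<lparr>carrier := A\<rparr>) rat_closure"
    using dense_algebraic_closure by blast
  interpret L: algebraic_closure "R\<lparr>carrier := A\<rparr>" rat_closure
    by (rule closure)
  have incl: "A \<subseteq> carrier R"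
    using subringE(1)[OF subfieldE(1)[OF A]] .
  have emb: "range (rat_emb R) \<subseteq> A"
    using rat_emb_in_rat_closure L.subset by auto
  have "\<exists>zs. set zs \<subseteq> A \<and> length zs = d \<and>
        (\<forall>x\<in>carrier R. v (F x \<ominus> w) = (\<Prod>z\<leftarrow>zs. v (x \<ominus> z)))" if w: "w \<in> A" for w
  proof -
    define cs where "cs = map (rat_emb R) (rev (coeffs f))"
    \<comment> \<open>The constant term comes last in the list, so this represents
      \<open>F - w\<close>; as \<open>d > 0\<close>, the leading coefficient is unchanged.\<close>
    define p where "p = butlast cs @ [last cs \<ominus> w]"
    have "f \<noteq> 0"
      using monic by auto
    then have len: "length cs = Suc d"
      by (simp add: cs_def degree_eq length_coeffs_degree)
    have "hd cs = \<one>"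
      using \<open>f \<noteq> 0\<close> monic
      by (simp add: cs_def hd_map hd_rev last_coeffs_eq_coeff_degree)
    moreover obtain c bs where "cs = c # bs"
      using len by (cases cs) auto
    moreover from this have "bs \<noteq> []"
      using len d_ge_2 by auto
    ultimately have "hd p = \<one>" "cs \<noteq> []"
      by (simp_all add: p_def)
    have cs: "set cs \<subseteq> A"
      using emb by (auto simp: cs_def)
    have last: "last cs \<in> A"
      using cs last_in_set[OF \<open>cs \<noteq> []\<close>] by blast
    have but: "set (butlast cs) \<subseteq> A"
      using cs by (auto dest: in_set_butlastD)
    have "last cs \<ominus> w \<in> A"
      using subringE(5,7)[OF subfieldE(1)[OF A]] last w by (simp add: a_minus_def)
    then have "set p \<subseteq> A" "length p = Suc d"
      using but len by (auto simp: p_def)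
    then obtain zs where zs: "set zs \<subseteq> A" "length zs = d"
        "\<And>x. x \<in> carrier R \<Longrightarrow> v (eval p x) = (\<Prod>z\<leftarrow>zs. v (x \<ominus> z))"
      using v_monic_eval_eq_prod_list[OF A L.algebraically_closed_axioms] \<open>hd p = \<one>\<close> by blast
    have "eval p x = F x \<ominus> w" if x: "x \<in> carrier R" for x
    proof -
      have c: "set (butlast cs) \<subseteq> carrier R" "last cs \<in> carrier R" "w \<in> carrier R"
        using but last w incl by auto
      have "F x = eval (butlast cs @ [last cs]) x"
        using \<open>cs \<noteq> []\<close> by (simp add: rat_poly_eval_def cs_def)
      also have "\<dots> = eval (butlast cs) x \<otimes> x \<oplus> last cs"
        by (rule eval_append_aux[OF c(1,2) x])
      finally have "F x = eval (butlast cs) x \<otimes> x \<oplus> last cs" .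
      moreover have "eval p x = eval (butlast cs) x \<otimes> x \<oplus> (last cs \<ominus> w)"
        unfolding p_def using c x by (intro eval_append_aux) auto
      ultimately show ?thesis
        using c x eval_in_carrier[OF c(1) x] by (simp add: a_minus_def a_assoc)
    qed
    then show ?thesis
      using zs by metis
  qed
  then show ?thesis
    using emb incl by blast
qed

text \<open>If all roots \<open>z\<close> of \<open>F = w\<close> were closer than \<open>r\<close> to \<open>x\<close>, then \<open>v (F y - w) \<le> r\<close> on \<open>J\<close> would
  confine \<open>J\<close> to a disk about \<open>x\<close> of radius smaller than \<open>r\<close>.\<close>

lemma ex_far_root:
  assumes r: "is_min_disk_radius R v J r" "r > 1"
    and w: "w \<in> J" and zs: "set zs \<subseteq> carrier R" "length zs = d"
    and F: "\<And>x. x \<in> carrier R \<Longrightarrow> v (F x \<ominus> w) = (\<Prod>z\<leftarrow>zs. v (x \<ominus> z))"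
    and x: "x \<in> carrier R"
  shows "\<exists>z\<in>set zs. r \<le> v (x \<ominus> z)"
proof (rule ccontr)
  assume "\<not> ?thesis"
  then have near: "\<And>z. z \<in> set zs \<Longrightarrow> v (x \<ominus> z) < r"
    by force
  \<comment> \<open>The disk of radius \<open>s\<close> about \<open>x\<close> contains every root.
    Including \<open>root d r\<close> yields \<open>r \<le> s ^ d\<close>, and \<open>r > 1\<close>
    still keeps \<open>s\<close> below \<open>r\<close>.\<close>
  define s where "s = Max (insert (root d r) ((\<lambda>z. v (x \<ominus> z)) ` set zs))"
  have "root d r < r"
  proof -
    have "root d r < root d (r ^ d)"
      using r(2) d_ge_2 power_strict_increasing[of 1 d r] by simp
    then show ?thesis
      using r(2) d_ge_2 by (simp add: real_root_power_cancel)
  qed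
  then have "s < r"
    unfolding s_def using near by (subst Max_less_iff) auto
  have s_root: "root d r \<le> s" and s_near: "v (x \<ominus> z) \<le> s" if "z \<in> set zs" for z
    unfolding s_def using that by (auto intro!: Max_ge)
  have "zs \<noteq> []"
    using zs d_ge_2 by auto
  then have "root d r \<le> s"
    using s_root by (cases zs) auto
  moreover have "root d r > 0"
    using r(2) d_ge_2 by simp
  ultimately have "s > 0" "root d r ^ d \<le> s ^ d"
    by (auto intro: power_mono)
  then have "r \<le> s ^ d"
    using r(2) d_ge_2 by (simp add: real_root_pow_pos2)
  obtain a where a: "a \<in> carrier R" "J \<subseteq> closed_disk R v a r"
    and min: "\<And>t b. t > 0 \<Longrightarrow> b \<in> carrier R \<Longrightarrow> J \<subseteq> closed_disk R v b t \<Longrightarrow> r \<le> t"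
    using r(1) unfolding is_min_disk_radius_def Let_def by auto
  have "v (y \<ominus> x) \<le> s" if y: "y \<in> J" for y
  proof (rule ccontr)
    assume far: "\<not> v (y \<ominus> x) \<le> s"
    have yR: "y \<in> carrier R"
      using y by (rule J_carrier)
    \<comment> \<open>Seen from a point \<open>y\<close> outside that disk, no root is closer than
      \<open>x\<close>, by the ultrametric inequality.\<close>
    have "v (y \<ominus> x) \<le> v (y \<ominus> z)" if z: "z \<in> set zs" for z
    proof -
      have "z \<in> carrier R"
        using z zs by auto
      then show ?thesis
        using ultrametric_diff[of y z x] v_minus_commute[of z x] s_near[OF z] far x yR by auto
    qed
    then have "v (y \<ominus> x) ^ d \<le> (\<Prod>z\<leftarrow>zs. v (y \<ominus> z))"
      using power_le_prod_list[of "v (y \<ominus> x)" "map (\<lambda>z. v (y \<ominus> z)) zs"] zs yR x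
      by (auto simp: v_nonneg)
    moreover have "s ^ d < v (y \<ominus> x) ^ d"
      using far \<open>s > 0\<close> d_ge_2 by (intro power_strict_mono) auto
    ultimately have "r < v (F y \<ominus> w)"
      using \<open>r \<le> s ^ d\<close> F[OF yR] by simp
    moreover have "F y \<in> J"
      using y yR rat_poly_eval_in_filled_julia_iff by simp
    then have "v (F y \<ominus> a) \<le> r" "v (w \<ominus> a) \<le> r"
      using a w by (auto simp: closed_disk_def)
    then have "v (F y \<ominus> w) \<le> r"
      using ultrametric_common[of "F y" w a r] a(1) yR J_carrier[OF w] by simp
    ultimately show False
      by simp
  qed
  then have "J \<subseteq> closed_disk R v x s"
    using J_carrier by (auto simp: closed_disk_def)
  then show False
    using min[OF \<open>s > 0\<close> x] \<open>s < r\<close> by simp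
qed

text \<open>\<open>ex_far_root\<close> supplies one factor of size at least \<open>r\<close>, so
  some other factor is small. The near root is recorded by its index, giving labels in a set of size
  \<open>d\<close> that does not depend on \<open>x\<close>.\<close>

lemma ex_near_root:
  assumes r: "is_min_disk_radius R v J r" "r > 1"
    and w: "w \<in> J" and zs: "set zs \<subseteq> carrier R" "length zs = d"
    and F: "\<And>x. x \<in> carrier R \<Longrightarrow> v (F x \<ominus> w) = (\<Prod>z\<leftarrow>zs. v (x \<ominus> z))"
    and x: "x \<in> carrier R" "v (F x \<ominus> w) \<le> V"
  shows "\<exists>i<d. v (x \<ominus> zs ! i) ^ (d - 1) \<le> V / r"
proof -
  obtain z where z: "z \<in> set zs" "r \<le> v (x \<ominus> z)"
    using ex_far_root[OF r w zs F x(1)] by blast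
  have "\<exists>y\<in>set (map (\<lambda>z. v (x \<ominus> z)) zs). y ^ (d - 1) \<le> V / r"
  proof (rule ex_power_le_prod_list_div)
    show "v (x \<ominus> z) \<in> set (map (\<lambda>z. v (x \<ominus> z)) zs)"
      using z by simp
    show "prod_list (map (\<lambda>z. v (x \<ominus> z)) zs) \<le> V"
      using F[OF x(1)] x(2) by simp
    show "0 \<le> y" if "y \<in> set (map (\<lambda>z. v (x \<ominus> z)) zs)" for y
      using that zs x by (auto intro!: v_nonneg)
  qed (use zs d_ge_2 r z in auto)
  then show ?thesis
    using zs(2) by (auto simp: in_set_conv_nth)
qed

text \<open>The label \<open>i x\<close> is a root near \<open>x\<close> of \<open>F = w\<close>, for a rational preperiodic \<open>w\<close>, and \<open>j x\<close> is a
  root near \<open>x\<close> of \<open>F = z\<close>, where \<open>z\<close> is the root of \<open>F = w\<close> labelling \<open>F x\<close>.\<close>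

lemma ex_labels:
  assumes r: "is_min_disk_radius R v J r" "r > 1"
  shows "\<exists>(i :: rat \<Rightarrow> nat) (j :: rat \<Rightarrow> nat).
    (\<forall>x\<in>rat_preperiodic f. i x < d \<and> j x < d) \<and>
    (\<forall>x\<in>rat_preperiodic f. \<forall>y\<in>rat_preperiodic f. i x = i y \<longrightarrow> place_abs l (x - y) \<le> 1) \<and>
    (\<forall>x\<in>rat_preperiodic f. \<forall>y\<in>rat_preperiodic f. i (poly f x) = i (poly f y) \<longrightarrow> j x = j y \<longrightarrow>
        place_abs l (x - y) ^ (d - 1) \<le> 1 / r)"
proof (cases "rat_preperiodic f = {}")
  case False
  \<comment> \<open>Any rational preperiodic point serves as the first target
    \<open>w\<close>.\<close>
  then obtain c where c: "c \<in> rat_preperiodic f"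
    by blast
  let ?P = "rat_preperiodic f" and ?e = "rat_emb R"
  have eJ: "?e x \<in> J" if "x \<in> ?P" for x
    using rat_emb_preperiodic_in_filled_julia[OF that] .
  obtain A where A: "range ?e \<subseteq> A" "A \<subseteq> carrier R" and
    split: "\<And>w. w \<in> A \<Longrightarrow> \<exists>zs. set zs \<subseteq> A \<and> length zs = d \<and>
        (\<forall>x\<in>carrier R. v (F x \<ominus> w) = (\<Prod>z\<leftarrow>zs. v (x \<ominus> z)))"
    using ex_algebraic_splitting by blast
  obtain zs where zs: "set zs \<subseteq> A" "length zs = d" and
    F: "\<And>x. x \<in> carrier R \<Longrightarrow> v (F x \<ominus> ?e c) = (\<Prod>z\<leftarrow>zs. v (x \<ominus> z))"
    using split[of "?e c"] A by blast
  have zsR: "set zs \<subseteq> carrier R"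
    using zs(1) A(2) by blast
  \<comment> \<open>Membership in \<open>J\<close> is what allows these roots to be targets in the
    second application of \<open>ex_near_root\<close>.\<close>
  have zs_J: "z \<in> J" if z: "z \<in> set zs" for z
  proof -
    have zR: "z \<in> carrier R"
      using z zsR by blast
    then have "v (F z \<ominus> ?e c) = 0"
      using z v_eq_0[of "z \<ominus> z"] by (auto simp: F prod_list_zero_iff image_iff intro!: bexI[of _ z])
    then have "F z = ?e c"
      using v_eq_0[of "F z \<ominus> ?e c"] zR by simp
    then show ?thesis
      using eJ[OF c] rat_poly_eval_in_filled_julia_iff[OF zR] by metis
  qed
  \<comment> \<open>Coarse labels: here \<open>V = r\<close>, as two points of \<open>J\<close> are
    at distance at most \<open>r\<close>.\<close>
  have "\<exists>i<d. v (?e x \<ominus> zs ! i) \<le> 1" if x: "x \<in> ?P" for x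
  proof -
    obtain a where a: "a \<in> carrier R" "J \<subseteq> closed_disk R v a r"
      using r(1) unfolding is_min_disk_radius_def Let_def by auto
    have "F (?e x) \<in> J"
      using eJ[OF x] rat_poly_eval_in_filled_julia_iff by simp
    then have "v (F (?e x) \<ominus> a) \<le> r" "v (?e c \<ominus> a) \<le> r"
      using a(2) eJ[OF c] unfolding closed_disk_def by blast+
    then have near: "v (F (?e x) \<ominus> ?e c) \<le> r"
      by (rule ultrametric_common[OF _ _ a(1), rotated 2]) simp_all
    have "\<exists>i<d. v (?e x \<ominus> zs ! i) ^ (d - 1) \<le> r / r"
      by (rule ex_near_root[OF r eJ[OF c] zsR zs(2) F rat_emb_closed near])
    then obtain i where "i < d" "v (?e x \<ominus> zs ! i) ^ (d - 1) \<le> 1"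
      using r(2) by auto
    moreover from this have "zs ! i \<in> carrier R"
      using zsR zs(2) nth_mem by blast
    then have "0 \<le> v (?e x \<ominus> zs ! i)"
      by (simp add: v_nonneg)
    ultimately have "i < d" "v (?e x \<ominus> zs ! i) \<le> 1"
      using d_ge_2 by (auto simp: power_le_one_iff)
    then show ?thesis
      by blast
  qed
  then obtain i where i: "\<And>x. x \<in> ?P \<Longrightarrow> i x < d"
      "\<And>x. x \<in> ?P \<Longrightarrow> v (?e x \<ominus> zs ! i x) \<le> 1"
    by metis
  have zs_i: "zs ! i x \<in> A" "zs ! i x \<in> J" "zs ! i x \<in> carrier R" if "x \<in> ?P" for x
    using i(1)[OF that] zs zs_J zsR by (metis nth_mem subsetD)+
  obtain zss where zss: "\<And>w. w \<in> A \<Longrightarrow> set (zss w) \<subseteq> A" "\<And>w. w \<in> A \<Longrightarrow> length (zss w) = d"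
    and Fz: "\<And>w x. w \<in> A \<Longrightarrow> x \<in> carrier R \<Longrightarrow> v (F x \<ominus> w) = (\<Prod>z\<leftarrow>zss w. v (x \<ominus> z))"
    using split by metis
  \<comment> \<open>Fine labels: here \<open>V = 1\<close>, as \<open>F x\<close> is within 1 of the
    root that labels it.\<close>
  have "\<exists>j<d. v (?e x \<ominus> zss (zs ! i (poly f x)) ! j) ^ (d - 1) \<le> 1 / r" if x: "x \<in> ?P" for x
  proof (rule ex_near_root[OF r])
    show "v (F (?e x) \<ominus> zs ! i (poly f x)) \<le> 1"
      using i(2)[OF poly_in_rat_preperiodic[OF x]] by (simp add: rat_poly_eval_rat_emb)
    show "set (zss (zs ! i (poly f x))) \<subseteq> carrier R"
      using zss(1)[OF zs_i(1)[OF poly_in_rat_preperiodic[OF x]]] A(2) by (rule order_trans)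
  qed (use zs_i[OF poly_in_rat_preperiodic[OF x]] zss Fz in auto)
  then obtain j where j: "\<And>x. x \<in> ?P \<Longrightarrow> j x < d"
      "\<And>x. x \<in> ?P \<Longrightarrow> v (?e x \<ominus> zss (zs ! i (poly f x)) ! j x) ^ (d - 1) \<le> 1 / r"
    by metis
  have "place_abs l (x - y) \<le> 1" if "x \<in> ?P" "y \<in> ?P" "i x = i y" for x y
    using ultrametric_common[of "?e x" "?e y" "zs ! i x" 1] i(2)[of x] i(2)[of y] zs_i[of x] that
    by (simp flip: v_rat_emb_diff)
  moreover have "place_abs l (x - y) ^ (d - 1) \<le> 1 / r"
    if xy: "x \<in> ?P" "y \<in> ?P" "i (poly f x) = i (poly f y)" "j x = j y" for x y
  proof -
    \<comment> \<open>Equal coarse labels of the images select the same root list, so equal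
      \<open>j\<close> labels select the same root \<open>z\<close> for \<open>x\<close> and
      \<open>y\<close>.\<close>
    define z where "z = zss (zs ! i (poly f x)) ! j x"
    have "z \<in> carrier R"
      using zss zs_i(1)[OF poly_in_rat_preperiodic[OF xy(1)]] j(1)[OF xy(1)] A(2) unfolding z_def
      by (metis nth_mem subsetD)
    then have "v (?e x \<ominus> ?e y) \<le> max (v (?e x \<ominus> z)) (v (?e y \<ominus> z))"
      using ultrametric_common by simp
    moreover have "v (?e x \<ominus> z) ^ (d - 1) \<le> 1 / r" "v (?e y \<ominus> z) ^ (d - 1) \<le> 1 / r"
      using j(2)[OF xy(1)] j(2)[OF xy(2)] xy by (simp_all add: z_def)
    moreover have "0 \<le> v (?e x \<ominus> ?e y)"
      by (simp add: v_nonneg)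
    ultimately have "v (?e x \<ominus> ?e y) ^ (d - 1) \<le> 1 / r"
      by (metis max_def order_trans power_mono)
    then show ?thesis
      by (simp add: v_rat_emb_diff)
  qed
  ultimately show ?thesis
    using i(1) j(1) by blast
qed auto

lemma good_place_abs_diff:
  assumes "is_min_disk_radius R v J 1" "x \<in> rat_preperiodic f" "y \<in> rat_preperiodic f"
  shows "place_abs l (x - y) \<le> 1"
proof -
  obtain a where a: "a \<in> carrier R" "J \<subseteq> closed_disk R v a 1"
    using assms(1) unfolding is_min_disk_radius_def Let_def by auto
  have "v (rat_emb R x \<ominus> a) \<le> 1" "v (rat_emb R y \<ominus> a) \<le> 1"
    using a(2) assms(2,3)[THEN rat_emb_preperiodic_in_filled_julia] unfolding closed_disk_def
    by blast+
  then have "v (rat_emb R x \<ominus> rat_emb R y) \<le> 1"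
    by (rule ultrametric_common[OF _ _ a(1), rotated 2]) simp_all
  then show ?thesis
    by (simp add: v_rat_emb_diff)
qed

end

section \<open>The product formula and the pigeonhole argument\<close>

lemma multiplicity_int_nat_abs:
  assumes "Factorial_Ring.prime p"
  shows "Factorial_Ring.multiplicity (int p) k = Factorial_Ring.multiplicity p (nat \<bar>k\<bar>)"
proof -
  have "int p ^ m dvd k \<longleftrightarrow> p ^ m dvd nat \<bar>k\<bar>" for m
    using int_dvd_int_iff[of "p ^ m" "nat \<bar>k\<bar>"] by simp
  then show ?thesis
    using assms by (cases "k = 0") (auto simp: multiplicity_def)
qed

lemma prod_prime_powers_eq:
  fixes N :: nat
  assumes "N > 0" "finite P" "prime_factors N \<subseteq> P" "\<And>p. p \<in> P \<Longrightarrow> Factorial_Ring.prime p"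
  shows "(\<Prod>p\<in>P. p ^ Factorial_Ring.multiplicity p N) = N"
proof -
  have "(\<Prod>p\<in>P. p ^ Factorial_Ring.multiplicity p N) =
      (\<Prod>p\<in>prime_factors N. p ^ Factorial_Ring.multiplicity p N)"
    using assms by (intro prod.mono_neutral_right)
      (auto simp: prime_factors_multiplicity)
  also have "\<dots> = N"
    using prime_factorization_nat[of N] assms(1) by simp
  finally show ?thesis .
qed

text \<open>By the product formula all factors multiply to 1, and those outside \<open>S\<close> are
  at most 1. Only finite products occur.\<close>

lemma product_formula_ge_1:
  assumes q: "q \<noteq> 0" and S: "finite S" "S \<subseteq> places_of_Q" "Infinite_Place \<in> S"
    and outside: "\<And>l. l \<in> places_of_Q \<Longrightarrow> l \<notin> S \<Longrightarrow> place_abs l q \<le> 1"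
  shows "1 \<le> (\<Prod>l\<in>S. place_abs l q)"
proof -
  obtain n m where nm: "quotient_of q = (n, m)"
    by fastforce
  define N M where "N = nat \<bar>n\<bar>" and "M = nat \<bar>m\<bar>"
  have m: "m > 0" and qd: "q = of_int n / of_int m"
    using quotient_of_denom_pos[OF nm] quotient_of_div[OF nm] by auto
  then have NM: "N > 0" "M > 0"
    using q by (auto simp: N_def M_def)
  have nonneg: "0 \<le> place_abs l q" for l
    by (cases l) auto
  \<comment> \<open>These primes cover the finite places of \<open>S\<close> and every prime at
    which \<open>q\<close> has absolute value different from 1.\<close>
  define P where "P = {p. Finite_Place p \<in> S} \<union> prime_factors N \<union> prime_factors M"
  have "finite (Finite_Place -` S)"
    using S(1) by (rule finite_vimageI) (auto simp: inj_on_def)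
  then have finP: "finite P"
    by (simp add: P_def vimage_def)
  have primeP: "Factorial_Ring.prime p" if "p \<in> P" for p
    using that S(2) by (auto simp: P_def places_of_Q_def)
  define T where "T = insert Infinite_Place (Finite_Place ` P)"
  have ST: "S \<subseteq> T"
  proof
    fix l assume "l \<in> S"
    then show "l \<in> T"
      by (cases l) (auto simp: T_def P_def)
  qed
  have T: "finite T" "T \<subseteq> places_of_Q"
    using finP primeP by (auto simp: T_def places_of_Q_def)
  have "(\<Prod>p\<in>P. place_abs (Finite_Place p) q) =
      (\<Prod>p\<in>P. real (p ^ Factorial_Ring.multiplicity p M) / real (p ^ Factorial_Ring.multiplicity p N))"
  proof (rule prod.cong[OF refl])
    fix p assume "p \<in> P"
    then have "Factorial_Ring.prime p"
      by (rule primeP)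
    moreover from this have "p \<noteq> 0"
      by auto
    ultimately show "place_abs (Finite_Place p) q =
        real (p ^ Factorial_Ring.multiplicity p M) / real (p ^ Factorial_Ring.multiplicity p N)"
      using q by (simp add: nm multiplicity_int_nat_abs N_def M_def power_int_diff)
  qed
  also have "\<dots> = real (\<Prod>p\<in>P. p ^ Factorial_Ring.multiplicity p M) /
      real (\<Prod>p\<in>P. p ^ Factorial_Ring.multiplicity p N)"
    by (simp add: prod_dividef)
  also have "\<dots> = real M / real N"
    using prod_prime_powers_eq[OF NM(1) finP _ primeP] prod_prime_powers_eq[OF NM(2) finP _ primeP]
    by (metis P_def Un_upper1 Un_upper2 le_supI1)
  finally have finite_places: "(\<Prod>p\<in>P. place_abs (Finite_Place p) q) = real M / real N" .
  have "(\<Prod>l\<in>T. place_abs l q) =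
      place_abs Infinite_Place q * (\<Prod>p\<in>P. place_abs (Finite_Place p) q)"
  proof -
    have "Infinite_Place \<notin> Finite_Place ` P" "inj_on Finite_Place P"
      by (auto simp: inj_on_def)
    then show ?thesis
      unfolding T_def using finP by (simp add: prod.reindex del: place_abs.simps)
  qed
  also note finite_places
  also have "place_abs Infinite_Place q = real N / real M"
    using m by (simp add: qd N_def M_def of_rat_divide)
  finally have one: "(\<Prod>l\<in>T. place_abs l q) = 1"
    using NM by simp
  have "(\<Prod>l\<in>T. place_abs l q) = (\<Prod>l\<in>T - S. place_abs l q) * (\<Prod>l\<in>S. place_abs l q)"
    by (rule prod.subset_diff[OF ST T(1)])
  also have "\<dots> \<le> 1 * (\<Prod>l\<in>S. place_abs l q)"
    using nonneg outside T(2) by (intro mult_right_mono prod_le_1 prod_nonneg) auto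
  finally show ?thesis
    using one by simp
qed

text \<open>Finiteness is stated explicitly because \<open>card\<close> is 0 on infinite
  sets.\<close>

theorem mainTheorem3:
  fixes d :: nat
    and g :: "nat \<Rightarrow> rat poly"
    and K :: "place \<Rightarrow> 'a ring"
    and v :: "place \<Rightarrow> 'a \<Rightarrow> real"
    and A B C :: "nat \<Rightarrow> place set"
    and r :: "nat \<Rightarrow> place \<Rightarrow> real"
  assumes C_l: "\<And>l. l \<in> places_of_Q \<Longrightarrow> completed_algebraic_closure (K l) (v l) l"
    and d: "d \<ge> 2"
    and g: "\<And>n. n \<ge> 1 \<Longrightarrow> Polynomial.lead_coeff (g n) = 1 \<and> Polynomial.degree (g n) = d"
    and partition: "\<And>n. n \<ge> 1 \<Longrightarrow>
          places_of_Q = A n \<union> B n \<union> C n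
          \<and> A n \<inter> B n = {} \<and> A n \<inter> C n = {} \<and> B n \<inter> C n = {}"
    and good: "\<And>n l. n \<ge> 1 \<Longrightarrow> l \<in> A n \<Longrightarrow>
          is_min_disk_radius (K l) (v l) (filled_julia (K l) (v l) (g n)) 1"
    and B_stable: "\<And>n. n \<ge> 1 \<Longrightarrow> B n = B 1"
    and B_finite: "finite (B 1)"
    and B_infinite_place: "Infinite_Place \<in> B 1"
    and controlled: "\<And>l. l \<in> B 1 \<Longrightarrow> \<exists>R \<ge> 1. \<forall>n \<ge> 1.
          filled_julia (K l) (v l) (g n) \<inter> valued_field.rat_closure (K l) (v l)
            \<subseteq> closed_disk (K l) (v l) \<zero>\<^bsub>K l\<^esub> R"
    and C_stable: "\<And>n. n \<ge> 1 \<Longrightarrow> card (C n) = card (C 1)"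
    and uncontrolled: "\<And>n l. n \<ge> 1 \<Longrightarrow> l \<in> C n \<Longrightarrow>
          is_min_disk_radius (K l) (v l) (filled_julia (K l) (v l) (g n)) (r n l)"
    and radii_at_top: "filterlim (\<lambda>n. Min (r n ` C n)) at_top sequentially"
    and C_nonempty: "card (C 1) \<ge> 1"
  shows "\<forall>\<^sub>F n in sequentially.
           finite (rat_preperiodic (g n)) \<and> card (rat_preperiodic (g n)) \<le> d ^ (card (C n) + 1)"
proof -
  obtain R where R: "\<And>l. l \<in> B 1 \<Longrightarrow> R l \<ge> 1"
    "\<And>l n. l \<in> B 1 \<Longrightarrow> n \<ge> 1 \<Longrightarrow>
        filled_julia (K l) (v l) (g n) \<inter> valued_field.rat_closure (K l) (v l)
          \<subseteq> closed_disk (K l) (v l) \<zero>\<^bsub>K l\<^esub> (R l)"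
    using controlled by metis
  \<comment> \<open>\<open>M\<close> bounds, uniformly in \<open>n\<close>, the contribution of the
    controlled places to the product formula.\<close>
  define M where "M = (\<Prod>l\<in>B 1. 2 * R l)"
  have "M \<ge> 0"
    unfolding M_def using R(1) by (intro prod_nonneg) force
  \<comment> \<open>Radii above 1 are needed for \<open>ex_labels\<close>, radii above
    \<open>M ^ (d - 1)\<close> for the final contradiction.\<close>
  have "\<forall>\<^sub>F n in sequentially. max 1 (M ^ (d - 1)) < Min (r n ` C n)"
    using radii_at_top unfolding filterlim_at_top_dense by (rule spec)
  then have "\<forall>\<^sub>F n in sequentially. n \<ge> 1 \<and> max 1 (M ^ (d - 1)) < Min (r n ` C n)"
    using eventually_ge_at_top[of 1] by (rule eventually_conj[rotated])
  then show ?thesis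
  proof (rule eventually_mono)
    fix n assume "n \<ge> 1 \<and> max 1 (M ^ (d - 1)) < Min (r n ` C n)"
    then have n: "n \<ge> 1" and min: "max 1 (M ^ (d - 1)) < Min (r n ` C n)"
      by auto
    have card: "card (C n) \<ge> 1"
      using C_stable[OF n] C_nonempty by simp
    then have finC: "finite (C n)"
      using card.infinite by fastforce
    have Bn: "B n = B 1"
      by (rule B_stable[OF n])
    note parts = partition[OF n, unfolded Bn]
    have places: "A n \<subseteq> places_of_Q" "B 1 \<subseteq> places_of_Q" "C n \<subseteq> places_of_Q"
      using parts by blast+
    let ?P = "rat_preperiodic (g n)"
    have at_place: "completed_algebraic_closure_at_place (K l) (v l) l" if "l \<in> places_of_Q" for l
      using C_l[OF that] that
      by (simp add: completed_algebraic_closure_at_place_def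
          completed_algebraic_closure_at_place_axioms_def)
    have dyn: "nonarchimedean_dynamics (K l) (v l) l (g n) d" if "l \<in> A n \<union> C n" for l
    proof -
      have "l \<in> places_of_Q" "l \<noteq> Infinite_Place"
        using that parts B_infinite_place by blast+
      then show ?thesis
        using at_place[of l] d g[OF n]
        by (intro nonarchimedean_dynamics.intro nonarchimedean_dynamics_axioms.intro) blast+
    qed
    have r_large: "1 < r n l" "M ^ (d - 1) < r n l" if "l \<in> C n" for l
    proof -
      have "Min (r n ` C n) \<le> r n l"
        using finC that by simp
      then show "1 < r n l" "M ^ (d - 1) < r n l"
        using min by auto
    qed
    define labelling where "labelling l i j \<longleftrightarrow> (\<forall>x\<in>?P. i x < d \<and> j x < d) \<and>
      (\<forall>x\<in>?P. \<forall>y\<in>?P. i x = i y \<longrightarrow> place_abs l (x - y) \<le> 1) \<and>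
      (\<forall>x\<in>?P. \<forall>y\<in>?P. i (poly (g n) x) = i (poly (g n) y) \<longrightarrow> j x = j y \<longrightarrow>
        place_abs l (x - y) ^ (d - 1) \<le> 1 / r n l)" for l and i j :: "rat \<Rightarrow> nat"
    have "\<exists>i j. labelling l i j" if l: "l \<in> C n" for l
      unfolding labelling_def
      by (rule nonarchimedean_dynamics.ex_labels[OF dyn uncontrolled[OF n l] r_large(1)[OF l]])
        (use l in blast)
    then obtain i j where labelling: "\<And>l. l \<in> C n \<Longrightarrow> labelling l (i l) (j l)"
      by metis
    have less_d: "i l x < d" "j l x < d" if "l \<in> C n" "x \<in> ?P" for l x
      using labelling[OF that(1)] that(2) unfolding labelling_def by blast+
    have i: "place_abs l (x - y) \<le> 1"
      if "l \<in> C n" "x \<in> ?P" "y \<in> ?P" "i l x = i l y" for l x y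
      using labelling[OF that(1)] that(2-) unfolding labelling_def by blast
    have j: "place_abs l (x - y) ^ (d - 1) \<le> 1 / r n l"
      if "l \<in> C n" "x \<in> ?P" "y \<in> ?P"
        "i l (poly (g n) x) = i l (poly (g n) y)" "j l x = j l y" for l x y
      using labelling[OF that(1)] that(2-) unfolding labelling_def by blast
    obtain k where k: "k \<in> C n"
      using card by fastforce
    show "finite ?P \<and> card ?P \<le> d ^ (card (C n) + 1)"
    \<comment> \<open>A uniform bound on finite subsets gives finiteness and the cardinality bound
      together.\<close>
    proof (rule finite_if_finite_subsets_card_bdd, rule ccontr)
      fix G assume G: "G \<subseteq> ?P" "finite G" and large: "\<not> card G \<le> d ^ (card (C n) + 1)"
      \<comment> \<open>One label at each place of \<open>C n\<close> plus the extra
        \<open>j\<close> label at \<open>k\<close> gives \<open>d ^ (card (C n) + 1)\<close> values.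
        At \<open>k\<close> the first label is that of the image, as the fine partition
        requires.\<close>
      define \<Phi> where "\<Phi> x = (restrict (\<lambda>l. i l (if l = k then poly (g n) x else x)) (C n), j k x)"
        for x
      let ?L = "(C n \<rightarrow>\<^sub>E {..<d}) \<times> {..<d}"
      have "\<Phi> ` G \<subseteq> ?L"
        using G(1) k by (auto simp: \<Phi>_def intro!: less_d poly_in_rat_preperiodic)
      moreover have "finite ?L" "card ?L = d ^ (card (C n) + 1)"
        using finC by (simp_all add: finite_PiE card_funcsetE card_cartesian_product)
      ultimately have "\<not> inj_on \<Phi> G"
        using card_inj_on_le[of \<Phi> G ?L] large by auto
      then obtain x y where xy: "x \<in> G" "y \<in> G" "x \<noteq> y" "\<Phi> x = \<Phi> y"
        by (auto simp: inj_on_def)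
      have P: "x \<in> ?P" "y \<in> ?P"
        using xy G(1) by auto
      have labels: "i l (if l = k then poly (g n) x else x) = i l (if l = k then poly (g n) y else y)"
        if "l \<in> C n" for l
      proof -
        have "fst (\<Phi> x) l = fst (\<Phi> y) l"
          using xy(4) by simp
        then show ?thesis
          using that by (simp add: \<Phi>_def)
      qed
      define a where "a l = place_abs l (x - y)" for l
      have a_nonneg: "0 \<le> a l" for l
        unfolding a_def by (cases l) auto
      have a_k: "a k ^ (d - 1) \<le> 1 / r n k"
        unfolding a_def using j[OF k P] labels[OF k] xy(4) by (simp add: \<Phi>_def)
      have a_C: "a l \<le> 1" if "l \<in> C n - {k}" for l
        unfolding a_def using i[of l x y] labels[of l] P that by simp
      have a_B: "a l \<le> 2 * R l" if "l \<in> B 1" for l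
      proof -
        interpret completed_algebraic_closure_at_place "K l" "v l" l
          using at_place that places by blast
        show ?thesis
          unfolding a_def using controlled_place_abs_diff[OF R(2)[OF that n] P] .
      qed
      have a_A: "a l \<le> 1" if "l \<in> A n" for l
        unfolding a_def
        using nonarchimedean_dynamics.good_place_abs_diff[OF dyn good[OF n that] P] that by simp
      have B_prod: "(\<Prod>l\<in>B 1. a l) \<le> M"
        unfolding M_def using a_nonneg a_B by (intro prod_mono) auto
      \<comment> \<open>Every remaining place lies in \<open>A n\<close>, where
        \<open>a l \<le> 1\<close>.\<close>
      have "1 \<le> (\<Prod>l\<in>B 1 \<union> C n. a l)"
        unfolding a_def
      proof (rule product_formula_ge_1)
        show "place_abs l (x - y) \<le> 1" if "l \<in> places_of_Q" "l \<notin> B 1 \<union> C n" for l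
          using a_A[of l] that parts unfolding a_def by blast
      qed (use xy B_finite finC places B_infinite_place in auto)
      also have "\<dots> = (\<Prod>l\<in>B 1. a l) * (\<Prod>l\<in>C n. a l)"
        using parts by (intro prod.union_disjoint B_finite finC) auto
      also have "(\<Prod>l\<in>C n. a l) = a k * (\<Prod>l\<in>C n - {k}. a l)"
        by (rule prod.remove[OF finC k])
      also have "(\<Prod>l\<in>B 1. a l) * \<dots> \<le> M * (a k * 1)"
        using B_prod \<open>M \<ge> 0\<close> a_nonneg a_C
        by (intro mult_mono prod_le_1 mult_nonneg_nonneg prod_nonneg) auto
      finally have "1 \<le> M * a k"
        by simp
      \<comment> \<open>Raising to the power \<open>d - 1\<close> matches the form of
        \<open>a_k\<close> and avoids roots of \<open>r n k\<close>.\<close>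
      then have "1 \<le> (M * a k) ^ (d - 1)"
        by (rule one_le_power)
      also have "\<dots> = M ^ (d - 1) * a k ^ (d - 1)"
        by (rule power_mult_distrib)
      also have "\<dots> \<le> M ^ (d - 1) * (1 / r n k)"
        using a_k \<open>M \<ge> 0\<close> by (intro mult_left_mono) auto
      also have "\<dots> < 1"
        using r_large[OF k] by simp
      finally show False
        by simp
    qed
  qed
qed

end
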